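(* For any real number $c>0$ and integers $M,m$ with $M>m\geq 2$, there exist a constant $\alpha>0$ and an integer $N$ such that the following holds. If $\{G_n\}$ is a family of graphs satisfying $v(G_n)=n$, $e(G_n)\geq c\,n^{1+1/m}$ and $\mathrm{girth}(G_n)>2m$, then for all $n\geq N$ and all integers $\ell$ with $m+1\leq \ell\leq M$, the number of $2\ell$-cycles in $G_n$ is at least $\alpha\, n^{2\ell/m}$.
   Context: All graphs are finite simple graphs. $v(G)$ denotes the order (number of vertices) of $G$ and $e(G)$ its size (number of edges). A $j$-cycle in $G$ is a cycle of length $j$ in $G$ (cycles are counted as subgraphs). The girth of $G$ is the length of a shortest cycle in $G$. The constants $\alpha$ and $N$ depend only on $c$, $M$, $m$. *)

theory Defs
  imports Complex_Main "HOL-Library.Extended_Nat"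
begin

record 'a ugraph =
  vertices :: "'a set"
  edges :: "'a set set"

definition simple_graph :: "'a ugraph \<Rightarrow> bool" where
  "simple_graph G \<longleftrightarrow>
     finite (vertices G) \<and> (\<forall>e\<in>edges G. e \<subseteq> vertices G \<and> card e = 2)"

definition graph_order :: "'a ugraph \<Rightarrow> nat" where
  "graph_order G = card (vertices G)"

definition graph_size :: "'a ugraph \<Rightarrow> nat" where
  "graph_size G = card (edges G)"

definition is_subgraph :: "'a ugraph \<Rightarrow> 'a ugraph \<Rightarrow> bool" where
  "is_subgraph H G \<longleftrightarrow> vertices H \<subseteq> vertices G \<and> edges H \<subseteq> edges G"

definition is_cycle_graph :: "nat \<Rightarrow> 'a ugraph \<Rightarrow> bool" where
  "is_cycle_graph j C \<longleftrightarrow> 3 \<le> j \<and>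
     (\<exists>xs. distinct xs \<and> length xs = j \<and> vertices C = set xs \<and>
           edges C = {{xs ! i, xs ! (Suc i mod j)} | i. i < j})"

(* A cycle is a subgraph, not a vertex sequence: the 2 * j choices of a starting
   point and a direction give the same element. *)
definition cycles_in :: "'a ugraph \<Rightarrow> nat \<Rightarrow> 'a ugraph set" where
  "cycles_in G j = {C. is_cycle_graph j C \<and> is_subgraph C G}"

(* An acyclic graph has girth \<infinity>, the infimum of the empty set. *)
definition girth :: "'a ugraph \<Rightarrow> enat" where
  "girth G = (INF j \<in> {j. cycles_in G j \<noteq> {}}. enat j)"

end

theory Submission
  imports Defs "HOL-Analysis.Convex"
begin

text \<open>
  A graph with at least $c\,n^{1+1/m}$ edges contains a subgraph $H$ of minimum degree at least
  $c\,n^{1/m}$. As the girth exceeds $2m$, non-backtracking walks of length $m$ with the same two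
  ends coincide, so a vertex of degree $\Delta$ has at least $\Delta (c\,n^{1/m}-1)^{m-1}$ vertices
  at distance $m$; hence all degrees of $H$ are $O(n^{1/m})$.

  By Cauchy--Schwarz $H$ has at least $(c\,n^{1/m})^{2l}$ closed walks of length $2l$. A closed walk
  of length $k \le 2m$ has to backtrack, which leaves $O(\Delta^{k/2})$ of them at each vertex, and
  from there $O(\Delta^{k-m})$ for $k \ge 2m$. A closed walk that repeats a vertex splits there into
  two shorter closed walks, and since $l > m$ these bounds show that only $O(n^{(2l-1)/m})$ closed
  walks of length $2l$ do so. The others trace $2l$-cycles, each of them boundedly often.
\<close>

section \<open>Walks\<close>

definition adj :: "'a ugraph \<Rightarrow> 'a \<Rightarrow> 'a \<Rightarrow> bool" where
  "adj G u v \<longleftrightarrow> {u, v} \<in> edges G"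

definition nbrs :: "'a ugraph \<Rightarrow> 'a \<Rightarrow> 'a set" where
  "nbrs G u = {v. adj G u v}"

text \<open>A walk is the list of its k + 1 vertices, so \<open>k\<close> counts edges. The walk
  \<open>[u]\<close> of length 0 exists for every \<open>u\<close>, even outside
  \<open>vertices G\<close>; this is why splitting a walk at a vertex of \<open>G\<close> assumes
  \<open>u \<in> vertices G\<close>.\<close>

definition walks :: "'a ugraph \<Rightarrow> nat \<Rightarrow> 'a \<Rightarrow> 'a \<Rightarrow> 'a list set" where
  "walks G k u v = {xs. length xs = Suc k \<and> xs ! 0 = u \<and> xs ! k = v \<and>
     (\<forall>i<k. adj G (xs ! i) (xs ! Suc i))}"

definition num_walks :: "'a ugraph \<Rightarrow> nat \<Rightarrow> 'a \<Rightarrow> 'a \<Rightarrow> nat" where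
  "num_walks G k u v = card (walks G k u v)"

lemma adj_sym: "adj G u v \<longleftrightarrow> adj G v u"
  by (simp add: adj_def insert_commute)

lemma num_walks_0: "num_walks G 0 u v = of_bool (u = v)"
proof -
  have "walks G 0 u v = (if u = v then {[u]} else {})"
    by (auto simp: walks_def length_Suc_conv)
  then show ?thesis by (simp add: num_walks_def)
qed

lemma walks_Suc: "walks G (Suc k) u v = (\<Union>x\<in>nbrs G u. Cons u ` walks G k x v)"
proof (intro equalityI subsetI)
  fix xs assume xs: "xs \<in> walks G (Suc k) u v"
  then obtain ys where ys: "xs = u # ys"
    by (cases xs) (auto simp: walks_def)
  have "ys \<in> walks G k (ys ! 0) v" "ys ! 0 \<in> nbrs G u"
    using xs by (auto simp: walks_def ys nbrs_def All_less_Suc2)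
  then show "xs \<in> (\<Union>x\<in>nbrs G u. Cons u ` walks G k x v)"
    using ys by blast
next
  fix xs assume "xs \<in> (\<Union>x\<in>nbrs G u. Cons u ` walks G k x v)"
  then show "xs \<in> walks G (Suc k) u v"
    by (auto simp: walks_def nbrs_def All_less_Suc2)
qed

lemma num_walks_sym: "num_walks G k u v = num_walks G k v u"
proof -
  have "rev xs \<in> walks G k v u" if "xs \<in> walks G k u v" for xs u v
  proof -
    have "adj G (rev xs ! i) (rev xs ! Suc i)" if "i < k" for i
    proof -
      have "adj G (xs ! (k - Suc i)) (xs ! Suc (k - Suc i))"
        using \<open>xs \<in> walks G k u v\<close> that by (auto simp: walks_def)
      then show ?thesis
        using \<open>xs \<in> walks G k u v\<close> that
        by (simp add: walks_def rev_nth adj_sym Suc_diff_Suc)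
    qed
    then show ?thesis
      using that by (auto simp: walks_def rev_nth)
  qed
  then have "bij_betw rev (walks G k u v) (walks G k v u)"
    by (intro bij_betw_byWitness[where f' = rev]) auto
  then show ?thesis
    unfolding num_walks_def by (rule bij_betw_same_card)
qed

context
  fixes G :: "'a ugraph"
  assumes simple: "simple_graph G"
begin

lemma finite_vertices: "finite (vertices G)"
  using simple by (simp add: simple_graph_def)

lemma finite_edges: "finite (edges G)"
proof -
  have "edges G \<subseteq> Pow (vertices G)"
    using simple by (auto simp: simple_graph_def)
  then show ?thesis
    using finite_vertices finite_subset by blast
qed

lemma adj_vertices: "adj G u v \<Longrightarrow> u \<in> vertices G \<and> v \<in> vertices G"
  using simple by (auto simp: simple_graph_def adj_def)

lemma adj_irrefl: "\<not> adj G u u"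
  using simple by (auto simp: simple_graph_def adj_def)

lemma nbrs_subset: "nbrs G u \<subseteq> vertices G"
  using adj_vertices by (auto simp: nbrs_def)

lemma finite_nbrs: "finite (nbrs G u)"
  using nbrs_subset finite_vertices finite_subset by blast

lemma walks_subset:
  assumes "u \<in> vertices G"
  shows "walks G k u v \<subseteq> {xs. set xs \<subseteq> vertices G \<and> length xs = Suc k}"
proof clarify
  fix xs assume xs: "xs \<in> walks G k u v"
  have "xs ! i \<in> vertices G" if "i \<le> k" for i
  proof (cases i)
    case 0
    then show ?thesis using xs assms by (simp add: walks_def)
  next
    case (Suc j)
    then show ?thesis
      using xs that adj_vertices[of "xs ! j" "xs ! i"] by (auto simp: walks_def)
  qed
  then show "set xs \<subseteq> vertices G \<and> length xs = Suc k"
    using xs by (auto simp: walks_def in_set_conv_nth less_Suc_eq_le)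
qed

lemma finite_walks: "u \<in> vertices G \<Longrightarrow> finite (walks G k u v)"
  by (rule finite_subset[OF walks_subset finite_lists_length_eq[OF finite_vertices]])

lemma num_walks_Suc: "num_walks G (Suc k) u v = (\<Sum>x\<in>nbrs G u. num_walks G k x v)"
proof -
  have "card (walks G (Suc k) u v) = (\<Sum>x\<in>nbrs G u. card (Cons u ` walks G k x v))"
    unfolding walks_Suc
  proof (rule card_UN_disjoint[OF finite_nbrs])
    show "\<forall>x\<in>nbrs G u. finite (Cons u ` walks G k x v)"
      using finite_walks nbrs_subset by blast
    show "\<forall>x\<in>nbrs G u. \<forall>y\<in>nbrs G u. x \<noteq> y \<longrightarrow> Cons u ` walks G k x v \<inter> Cons u ` walks G k y v = {}"
      by (auto simp: walks_def)
  qed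
  then show ?thesis
    by (simp add: num_walks_def card_image)
qed

text \<open>This is A^(a+b) = A^a A^b for the adjacency matrix A, whose k-th power has the entries
  \<open>num_walks G k u v\<close>: walks are sorted by their vertex at time
  \<open>a\<close>.\<close>

lemma num_walks_add:
  "u \<in> vertices G \<Longrightarrow>
   num_walks G (a + b) u v = (\<Sum>x\<in>vertices G. num_walks G a u x * num_walks G b x v)"
proof (induction a arbitrary: u)
  case 0
  have "(\<Sum>x\<in>vertices G. num_walks G 0 u x * num_walks G b x v)
      = (\<Sum>x\<in>vertices G. if u = x then num_walks G b x v else 0)"
    by (intro sum.cong) (auto simp: num_walks_0)
  then show ?case using 0 finite_vertices by simp
next
  case (Suc a)
  have "num_walks G (Suc a + b) u v = (\<Sum>y\<in>nbrs G u. num_walks G (a + b) y v)"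
    by (simp add: num_walks_Suc)
  also have "\<dots> = (\<Sum>y\<in>nbrs G u. \<Sum>x\<in>vertices G. num_walks G a y x * num_walks G b x v)"
    using Suc.IH nbrs_subset by (intro sum.cong) auto
  also have "\<dots> = (\<Sum>x\<in>vertices G. \<Sum>y\<in>nbrs G u. num_walks G a y x * num_walks G b x v)"
    by (rule sum.swap)
  also have "\<dots> = (\<Sum>x\<in>vertices G. num_walks G (Suc a) u x * num_walks G b x v)"
    by (simp add: num_walks_Suc sum_distrib_right)
  finally show ?case .
qed

text \<open>Cutting at times \<open>a\<close> and \<open>a + b\<close> yields a walk from
  \<open>u\<close> to some x, a closed walk at x and a walk from x to \<open>v\<close>. With
  \<open>b = 2\<close> this handles backtracking, with general \<open>b\<close> repeated
  vertices.\<close>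

lemma card_walks_returning_le:
  assumes u: "u \<in> vertices G"
  shows "card {xs \<in> walks G (a + b + c) u v. xs ! a = xs ! (a + b)}
    \<le> (\<Sum>x\<in>vertices G. num_walks G a u x * num_walks G b x x * num_walks G c x v)"
    (is "card ?S \<le> _")
proof -
  \<comment> \<open>Neighbouring pieces share the cut vertex, so that each is again a walk. Dropping
    the shared vertex from the first two pieces lets the three concatenate to \<open>xs\<close>,
    whence injectivity.\<close>
  define f where
    "f xs = (take (Suc a) xs, take (Suc b) (drop a xs), drop (a + b) xs)" for xs :: "'a list"
  let ?T = "\<lambda>x. walks G a u x \<times> walks G b x x \<times> walks G c x v"
  have "inj_on f ?S"
  proof (rule inj_onI)
    fix xs ys assume "f xs = f ys"
    then have "take (Suc a) xs = take (Suc a) ys"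
      and "take (Suc b) (drop a xs) = take (Suc b) (drop a ys)"
      and d: "drop (a + b) xs = drop (a + b) ys"
      by (auto simp: f_def)
    then have "take a (take (Suc a) xs) = take a (take (Suc a) ys)"
      and "take b (take (Suc b) (drop a xs)) = take b (take (Suc b) (drop a ys))"
      by auto
    then have "take (a + b) xs = take (a + b) ys"
      by (simp add: take_add)
    with d have "take (a + b) xs @ drop (a + b) xs = take (a + b) ys @ drop (a + b) ys"
      by (simp only:)
    then show "xs = ys"
      by (simp only: append_take_drop_id)
  qed
  moreover have "f xs \<in> (\<Union>x\<in>vertices G. ?T x)" if xs: "xs \<in> ?S" for xs
  proof -
    have "set xs \<subseteq> vertices G" "length xs = Suc (a + b + c)"
      using xs walks_subset[OF u] by auto
    then have "xs ! a \<in> vertices G"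
      using nth_mem[of a xs] by auto
    moreover have "f xs \<in> ?T (xs ! a)"
    proof -
      have "length xs = Suc (a + b + c)" "xs ! 0 = u" "xs ! (a + b + c) = v"
        and "xs ! (a + b) = xs ! a" and adj: "\<And>i. i < a + b + c \<Longrightarrow> adj G (xs ! i) (xs ! Suc i)"
        using xs by (auto simp: walks_def)
      moreover have "adj G (xs ! (a + i)) (xs ! Suc (a + i))" if "i < b" for i
        using adj[of "a + i"] that by simp
      moreover have "adj G (xs ! (a + b + i)) (xs ! Suc (a + b + i))" if "i < c" for i
        using adj[of "a + b + i"] that by simp
      ultimately show ?thesis
        unfolding f_def walks_def by simp
    qed
    ultimately show ?thesis by (rule UN_I)
  qed
  then have "f ` ?S \<subseteq> (\<Union>x\<in>vertices G. ?T x)"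
    by (rule image_subsetI)
  moreover have "finite (\<Union>x\<in>vertices G. ?T x)"
    by (intro finite_UN_I finite_cartesian_product finite_vertices finite_walks u)
  ultimately have "card ?S \<le> card (\<Union>x\<in>vertices G. ?T x)"
    by (rule card_inj_on_le)
  also have "\<dots> \<le> (\<Sum>x\<in>vertices G. card (?T x))"
    by (rule card_UN_le[OF finite_vertices])
  finally show ?thesis
    by (simp add: num_walks_def card_cartesian_product mult.assoc)
qed

lemma num_walks_1: "num_walks G 1 u v = of_bool (adj G u v)"
proof -
  have "num_walks G 1 u v = (\<Sum>x\<in>nbrs G u. of_bool (x = v))"
    using num_walks_Suc[of 0 u v] by (simp add: num_walks_0)
  also have "\<dots> = of_bool (adj G u v)"
    using finite_nbrs by (simp add: nbrs_def of_bool_def)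
  finally show ?thesis .
qed

lemma num_walks_2: "num_walks G 2 v v = card (nbrs G v)"
proof -
  have "num_walks G 2 v v = (\<Sum>x\<in>nbrs G v. num_walks G 1 x v)"
    using num_walks_Suc[of 1 v v] by (simp add: numeral_2_eq_2)
  also have "\<dots> = (\<Sum>x\<in>nbrs G v. 1)"
    by (intro sum.cong) (use num_walks_1 in \<open>auto simp: nbrs_def adj_sym\<close>)
  finally show ?thesis by simp
qed

section \<open>Closed walks from below, by minimum degree and Cauchy-Schwarz\<close>

lemma power_le_sum_num_walks:
  assumes d: "\<And>v. v \<in> vertices G \<Longrightarrow> d \<le> card (nbrs G v)"
  shows "u \<in> vertices G \<Longrightarrow> d ^ k \<le> (\<Sum>v\<in>vertices G. num_walks G k u v)"
proof (induction k arbitrary: u)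
  case 0
  then show ?case using finite_vertices by (simp add: num_walks_0)
next
  case (Suc k)
  have "d ^ Suc k \<le> (\<Sum>x\<in>nbrs G u. d ^ k)"
    using d[OF Suc.prems] by simp
  also have "\<dots> \<le> (\<Sum>x\<in>nbrs G u. \<Sum>v\<in>vertices G. num_walks G k x v)"
    using Suc.IH nbrs_subset by (intro sum_mono) auto
  also have "\<dots> = (\<Sum>v\<in>vertices G. num_walks G (Suc k) u v)"
    unfolding num_walks_Suc by (rule sum.swap)
  finally show ?case .
qed

text \<open>A closed walk of length 2l at v consists of two walks of length l from v to its
  midpoint, so their number is the sum of the squares of \<open>num_walks G l v x\<close>. By
  Cauchy-Schwarz this is at least \<open>d ^ (2 * l)\<close> divided by the order, and summing over
  v cancels the order.\<close>

lemma power_le_sum_closed_walks: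
  assumes d: "\<And>v. v \<in> vertices G \<Longrightarrow> d \<le> card (nbrs G v)"
    and ne: "vertices G \<noteq> {}"
  shows "d ^ (2 * l) \<le> (\<Sum>v\<in>vertices G. num_walks G (2 * l) v v)"
proof -
  let ?n = "card (vertices G)"
  have "d ^ (2 * l) \<le> ?n * num_walks G (2 * l) v v" if v: "v \<in> vertices G" for v
  proof -
    have "real (d ^ (2 * l)) = (real (d ^ l))\<^sup>2"
      by (simp add: power_mult mult.commute)
    also have "\<dots> \<le> (\<Sum>x\<in>vertices G. real (num_walks G l v x))\<^sup>2"
    proof (rule power_mono)
      show "real (d ^ l) \<le> (\<Sum>x\<in>vertices G. real (num_walks G l v x))"
        unfolding of_nat_sum[symmetric] of_nat_le_iff
        by (rule power_le_sum_num_walks) (use d v in auto)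
    qed simp
    also have "\<dots> \<le> (\<Sum>x\<in>vertices G. (real (num_walks G l v x))\<^sup>2) * real ?n"
      by (rule sum_squared_le_sum_of_squares)
    also have "(\<Sum>x\<in>vertices G. (real (num_walks G l v x))\<^sup>2) = real (num_walks G (2 * l) v v)"
      unfolding mult_2 num_walks_add[OF v] of_nat_sum of_nat_mult
      by (intro sum.cong refl) (simp add: power2_eq_square num_walks_sym[of G l _ v])
    finally have "real (d ^ (2 * l)) \<le> real (?n * num_walks G (2 * l) v v)"
      by (simp add: mult.commute)
    then show ?thesis
      unfolding of_nat_le_iff .
  qed
  then have "(\<Sum>v\<in>vertices G. d ^ (2 * l)) \<le> (\<Sum>v\<in>vertices G. ?n * num_walks G (2 * l) v v)"
    by (rule sum_mono)
  then have "?n * d ^ (2 * l) \<le> ?n * (\<Sum>v\<in>vertices G. num_walks G (2 * l) v v)"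
    by (simp add: sum_distrib_left)
  then show ?thesis
    using ne finite_vertices by (simp add: card_gt_0_iff)
qed

end

section \<open>Cycles and non-backtracking walks\<close>

lemma cycles_in_empty_if_girth_gt:
  assumes "enat k < girth G" "j \<le> k"
  shows "cycles_in G j = {}"
proof (rule ccontr)
  assume "cycles_in G j \<noteq> {}"
  then have "girth G \<le> enat j"
    unfolding girth_def by (intro INF_lower) simp
  then have "girth G \<le> enat k"
    using assms(2) by (meson enat_ord_simps(1) order_trans)
  with assms(1) show False by simp
qed

lemma walks_segment:
  assumes xs: "xs \<in> walks G k u v" and ij: "i \<le> j" "j \<le> k"
  shows "take (Suc (j - i)) (drop i xs) \<in> walks G (j - i) (xs ! i) (xs ! j)"
proof -
  have "length xs = Suc k" and adj: "\<And>i. i < k \<Longrightarrow> adj G (xs ! i) (xs ! Suc i)"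
    using xs by (auto simp: walks_def)
  moreover have "adj G (xs ! (i + r)) (xs ! Suc (i + r))" if "r < j - i" for r
    using adj[of "i + r"] that ij by simp
  ultimately show ?thesis
    unfolding walks_def using ij by simp
qed

text \<open>The list does not repeat its first vertex: a closed walk \<open>xs\<close> of length k
  enters as \<open>take k xs\<close>, and the index modulo the length restores its last
  edge.\<close>

definition list_cycle :: "'a list \<Rightarrow> 'a ugraph" where
  "list_cycle ys = \<lparr>vertices = set ys,
     edges = {{ys ! i, ys ! (Suc i mod length ys)} | i. i < length ys}\<rparr>"

text \<open>The condition does not wrap around: in a closed walk nothing is asked at the base
  point.\<close>

definition nonbacktracking :: "'a list \<Rightarrow> bool" where
  "nonbacktracking xs \<longleftrightarrow> (\<forall>i. i + 2 < length xs \<longrightarrow> xs ! i \<noteq> xs ! (i + 2))"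

text \<open>The end \<open>v\<close> is fixed and the start is free, so that walks grow by
  \<open>Cons\<close>.\<close>

definition nb_walks :: "'a ugraph \<Rightarrow> nat \<Rightarrow> 'a \<Rightarrow> 'a list set" where
  "nb_walks G k v = {xs \<in> (\<Union>u\<in>vertices G. walks G k u v). nonbacktracking xs}"

context
  fixes G :: "'a ugraph"
  assumes simple: "simple_graph G"
begin

lemma finite_cycles_in: "finite (cycles_in G j)"
proof (rule finite_subset)
  show "cycles_in G j \<subseteq>
    (\<lambda>(A, B). \<lparr>vertices = A, edges = B\<rparr>) ` (Pow (vertices G) \<times> Pow (edges G))"
  proof
    fix C assume "C \<in> cycles_in G j"
    then have "C = (\<lambda>(A, B). \<lparr>vertices = A, edges = B\<rparr>) (vertices C, edges C)"
      and "(vertices C, edges C) \<in> Pow (vertices G) \<times> Pow (edges G)"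
      by (auto simp: cycles_in_def is_subgraph_def)
    then show "C \<in> (\<lambda>(A, B). \<lparr>vertices = A, edges = B\<rparr>) ` (Pow (vertices G) \<times> Pow (edges G))"
      by (rule image_eqI)
  qed
  show "finite ((\<lambda>(A, B). \<lparr>vertices = A, edges = B\<rparr>) ` (Pow (vertices G) \<times> Pow (edges G)))"
    using finite_vertices[OF simple] finite_edges[OF simple] by simp
qed

lemma list_cycle_in_cycles_in:
  assumes u: "u \<in> vertices G" and xs: "xs \<in> walks G k u u"
    and dist: "distinct (take k xs)" and k: "3 \<le> k"
  shows "list_cycle (take k xs) \<in> cycles_in G k"
proof -
  have len: "length xs = Suc k" and u': "xs ! 0 = xs ! k"
    and adj: "\<And>i. i < k \<Longrightarrow> adj G (xs ! i) (xs ! Suc i)"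
    using xs by (auto simp: walks_def)
  have sub: "set xs \<subseteq> vertices G"
    using walks_subset[OF simple u] xs by blast
  have edge: "{take k xs ! i, take k xs ! (Suc i mod k)} \<in> edges G" if "i < k" for i
  proof (cases "Suc i = k")
    case True
    then show ?thesis using adj[of i] k u' by (simp add: adj_def)
  next
    case False
    then show ?thesis using adj[of i] that by (simp add: adj_def)
  qed
  have "is_cycle_graph k (list_cycle (take k xs))"
    unfolding is_cycle_graph_def
    by (intro conjI exI[of _ "take k xs"] k dist) (auto simp: list_cycle_def len)
  moreover have "is_subgraph (list_cycle (take k xs)) G"
    using sub edge set_take_subset[of k xs] by (auto simp: is_subgraph_def list_cycle_def len)
  ultimately show ?thesis
    by (simp add: cycles_in_def)
qed

text \<open>If the first \<open>k\<close> vertices are distinct, the walk traces a cycle of length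
  \<open>k\<close>, unless \<open>k = 1\<close> (a loop, impossible) or \<open>k = 2\<close> (a
  backtrack). Otherwise a repeated vertex cuts out a shorter closed walk, and a backtrack found
  there is one of the whole walk.\<close>

lemma short_closed_walk_backtracks:
  assumes no_cycle: "\<And>j. j \<le> g \<Longrightarrow> cycles_in G j = {}"
  shows "u \<in> vertices G \<Longrightarrow> xs \<in> walks G k u u \<Longrightarrow> 0 < k \<Longrightarrow> k \<le> g \<Longrightarrow>
    \<exists>i. i + 2 \<le> k \<and> xs ! i = xs ! (i + 2)"
proof (induction k arbitrary: u xs rule: less_induct)
  case (less k)
  have len: "length xs = Suc k" and u: "xs ! 0 = u" "xs ! k = u"
    and adj: "\<And>i. i < k \<Longrightarrow> adj G (xs ! i) (xs ! Suc i)"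
    using less.prems by (auto simp: walks_def)
  show ?case
  proof (cases "distinct (take k xs)")
    case True
    then have "\<not> 3 \<le> k"
      using list_cycle_in_cycles_in[OF less.prems(1,2)] no_cycle[OF less.prems(4)] by blast
    then consider "k = 1" | "k = 2"
      using less.prems(3) by linarith
    then show ?thesis
    proof cases
      case 1
      then show ?thesis using adj[of 0] u adj_irrefl[OF simple] by simp
    next
      case 2
      then show ?thesis using u by (intro exI[of _ 0]) (simp add: numeral_2_eq_2)
    qed
  next
    case False
    then obtain i j where "i < k" "j < k" "i \<noteq> j" "xs ! i = xs ! j"
      using len by (auto simp: distinct_conv_nth)
    then obtain i j where ij: "i < j" "j < k" "xs ! i = xs ! j"
      by (metis linorder_neqE_nat)
    let ?ys = "take (Suc (j - i)) (drop i xs)"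
    have "?ys \<in> walks G (j - i) (xs ! i) (xs ! i)"
      using walks_segment[OF less.prems(2), of i j] ij by simp
    moreover have "xs ! i \<in> vertices G"
      using adj[of i] ij adj_vertices[OF simple] by auto
    moreover have "j - i < k" "0 < j - i" "j - i \<le> g"
      using ij less.prems(4) by auto
    ultimately obtain r where r: "r + 2 \<le> j - i" "?ys ! r = ?ys ! (r + 2)"
      using less.IH[of "j - i" "xs ! i" ?ys] by blast
    then have "xs ! (i + r) = xs ! (i + r + 2)"
      using len ij by simp
    with r ij show ?thesis by (intro exI[of _ "i + r"]) simp
  qed
qed

text \<open>A common first step can be removed. If the first steps differ, one walk reversed and
  then the other form a closed walk of length at most 2m, which has to backtrack. Inside either half
  this is excluded by assumption, and at the turn by the different first steps.\<close>

lemma nonbacktracking_walk_unique: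
  assumes no_cycle: "\<And>j. j \<le> 2 * m \<Longrightarrow> cycles_in G j = {}"
  shows "v \<in> vertices G \<Longrightarrow> xs \<in> walks G k u v \<Longrightarrow> ys \<in> walks G k u v \<Longrightarrow>
    nonbacktracking xs \<Longrightarrow> nonbacktracking ys \<Longrightarrow> k \<le> m \<Longrightarrow> xs = ys"
proof (induction k arbitrary: u xs ys)
  case 0
  then show ?case by (auto simp: walks_def length_Suc_conv)
next
  case (Suc k)
  obtain xs' where xs': "xs = u # xs'" "xs' \<in> walks G k (xs' ! 0) v"
    using Suc.prems(2) unfolding walks_Suc by (auto simp: walks_def)
  obtain ys' where ys': "ys = u # ys'" "ys' \<in> walks G k (ys' ! 0) v"
    using Suc.prems(3) unfolding walks_Suc by (auto simp: walks_def)
  have tl: "nonbacktracking zs" if "nonbacktracking (z # zs)" for z and zs :: "'a list"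
    unfolding nonbacktracking_def
  proof (intro allI impI)
    fix i assume "i + 2 < length zs"
    then show "zs ! i \<noteq> zs ! (i + 2)"
      using that[unfolded nonbacktracking_def, rule_format, of "Suc i"] by simp
  qed
  show ?case
  proof (cases "xs' ! 0 = ys' ! 0")
    case True
    then have "xs' = ys'"
      using Suc.IH[of xs' "xs' ! 0" ys'] Suc.prems xs' ys' tl by auto
    then show ?thesis using xs' ys' by simp
  next
    case False
    let ?K = "Suc k"
    \<comment> \<open>\<open>tl\<close> removes the second copy of \<open>u\<close>, which sits at
      position \<open>?K\<close>; the descriptions \<open>zs1\<close> and \<open>zs2\<close> overlap
      exactly there.\<close>
    define zs where "zs = rev xs @ tl ys"
    have len: "length xs = Suc ?K" "length ys = Suc ?K"
      and ends: "xs ! 0 = u" "ys ! 0 = u" "xs ! ?K = v" "ys ! ?K = v"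
      and adjx: "\<And>i. i < ?K \<Longrightarrow> adj G (xs ! i) (xs ! Suc i)"
      and adjy: "\<And>i. i < ?K \<Longrightarrow> adj G (ys ! i) (ys ! Suc i)"
      using Suc.prems by (auto simp: walks_def)
    have zs1: "zs ! i = xs ! (?K - i)" if "i \<le> ?K" for i
      using that len by (simp add: zs_def nth_append rev_nth)
    have zs2: "zs ! i = ys ! (i - ?K)" if "i \<ge> ?K" "i \<le> 2 * ?K" for i
    proof (cases "i = ?K")
      case True
      then show ?thesis using zs1[of i] ends by simp
    next
      case False
      then have "Suc (i - Suc ?K) = i - ?K" using that by simp
      then show ?thesis using that len False
        by (simp add: zs_def nth_append nth_tl)
    qed
    have "zs \<in> walks G (2 * ?K) v v"
      unfolding walks_def
    proof (intro CollectI conjI allI impI)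
      show "length zs = Suc (2 * ?K)" using len by (simp add: zs_def)
      show "zs ! 0 = v" using zs1[of 0] ends by simp
      show "zs ! (2 * ?K) = v" using zs2[of "2 * ?K"] ends by simp
      fix i assume i: "i < 2 * ?K"
      show "adj G (zs ! i) (zs ! Suc i)"
      proof (cases "i < ?K")
        case True
        then show ?thesis
          using adjx[of "k - i"] zs1[of i] zs1[of "Suc i"] by (simp add: adj_sym Suc_diff_le)
      next
        case False
        then have "Suc (i - ?K) = i - k" by simp
        with False show ?thesis
          using adjy[of "i - ?K"] zs2[of i] zs2[of "Suc i"] i by simp
      qed
    qed
    then obtain i where i: "i + 2 \<le> 2 * ?K" "zs ! i = zs ! (i + 2)"
      using short_closed_walk_backtracks[of "2 * m", OF no_cycle Suc.prems(1), of zs "2 * ?K"]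
        Suc.prems(6) by auto
    \<comment> \<open>A backtrack lies in reversed \<open>xs\<close>, in \<open>ys\<close>, or
      around the turn at \<open>?K\<close>. In the last case \<open>i = k\<close>, and the entries
      compared are the second vertices of \<open>xs\<close> and \<open>ys\<close>.\<close>
    consider "i + 2 \<le> ?K" | "i \<ge> ?K" | "i = k" using i by linarith
    then show ?thesis
    proof cases
      case 1
      define r where "r = ?K - (i + 2)"
      then have "?K - i = r + 2" "r + 2 < length xs" using 1 len by auto
      then have "xs ! (r + 2) = xs ! r"
        using i zs1[of i] zs1[of "i + 2"] 1 r_def by simp
      then show ?thesis
        using Suc.prems(4) \<open>r + 2 < length xs\<close> unfolding nonbacktracking_def by metis
    next
      case 2
      define r where "r = i - ?K"
      then have "i + 2 - ?K = r + 2" "r + 2 < length ys" using 2 i len by auto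
      then have "ys ! (r + 2) = ys ! r"
        using i zs2[of i] zs2[of "i + 2"] 2 r_def by simp
      then show ?thesis
        using Suc.prems(5) \<open>r + 2 < length ys\<close> unfolding nonbacktracking_def by metis
    next
      case 3
      then have "xs ! 1 = ys ! 1"
        using i zs1[of i] zs2[of "i + 2"] by simp
      with False show ?thesis using xs' ys' by simp
    qed
  qed
qed

section \<open>Bounding degrees by growing non-backtracking walks\<close>

lemma finite_nb_walks: "finite (nb_walks G k v)"
proof -
  have "finite (\<Union>u\<in>vertices G. walks G k u v)"
    by (intro finite_UN_I finite_vertices[OF simple] finite_walks[OF simple])
  then show ?thesis
    by (rule finite_subset[rotated]) (auto simp: nb_walks_def)
qed

lemma nb_walks_1: "(\<lambda>x. [x, v]) ` nbrs G v \<subseteq> nb_walks G 1 v"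
  using adj_vertices[OF simple, of v]
  by (auto simp: nb_walks_def nbrs_def walks_def nonbacktracking_def adj_sym)

text \<open>At its start, a non-backtracking walk extends by any neighbour other than its second
  vertex, which leaves at least \<open>d - 1\<close> choices. The length \<open>Suc k\<close>
  ensures that there is a second vertex.\<close>

lemma card_nb_walks_Suc:
  assumes d: "\<And>v. v \<in> vertices G \<Longrightarrow> d \<le> card (nbrs G v)"
  shows "card (nb_walks G (Suc k) v) * (d - 1) \<le> card (nb_walks G (Suc (Suc k)) v)"
proof -
  let ?S = "SIGMA xs:nb_walks G (Suc k) v. nbrs G (xs ! 0) - {xs ! 1}"
  have "card (nb_walks G (Suc k) v) * (d - 1) = (\<Sum>xs\<in>nb_walks G (Suc k) v. d - 1)"
    by simp
  also have "\<dots> \<le> (\<Sum>xs\<in>nb_walks G (Suc k) v. card (nbrs G (xs ! 0) - {xs ! 1}))"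
  proof (rule sum_mono)
    fix xs assume "xs \<in> nb_walks G (Suc k) v"
    then have "xs ! 0 \<in> vertices G"
      by (auto simp: nb_walks_def walks_def)
    then have "d \<le> card (nbrs G (xs ! 0))" by (rule d)
    moreover have "card (nbrs G (xs ! 0)) - 1 \<le> card (nbrs G (xs ! 0) - {xs ! 1})"
      by (simp add: card_Diff_singleton_if)
    ultimately show "d - 1 \<le> card (nbrs G (xs ! 0) - {xs ! 1})" by linarith
  qed
  also have "\<dots> = card ?S"
    using finite_nb_walks finite_nbrs[OF simple] by (subst card_SigmaI) auto
  also have "\<dots> \<le> card (nb_walks G (Suc (Suc k)) v)"
  proof (rule card_inj_on_le[where f = "\<lambda>(xs, y). y # xs"])
    show "inj_on (\<lambda>(xs, y). y # xs) ?S" by (auto simp: inj_on_def)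
    show "finite (nb_walks G (Suc (Suc k)) v)" by (rule finite_nb_walks)
    show "(\<lambda>(xs, y). y # xs) ` ?S \<subseteq> nb_walks G (Suc (Suc k)) v"
    proof (rule image_subsetI)
      fix p assume "p \<in> ?S"
      then obtain xs y where p: "p = (xs, y)" and xs: "xs \<in> nb_walks G (Suc k) v"
        and y: "y \<in> nbrs G (xs ! 0)" "y \<noteq> xs ! 1"
        by auto
      have "adj G y (xs ! 0)" using y by (simp add: nbrs_def adj_sym)
      moreover have "xs \<in> walks G (Suc k) (xs ! 0) v"
        using xs by (auto simp: nb_walks_def walks_def)
      ultimately have "y # xs \<in> walks G (Suc (Suc k)) y v"
        unfolding walks_Suc[of G "Suc k"] by (auto simp: nbrs_def)
      moreover have "y \<in> vertices G"
        using y nbrs_subset[OF simple] by blast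
      moreover have "nonbacktracking (y # xs)"
        unfolding nonbacktracking_def
      proof (intro allI impI)
        fix i assume "i + 2 < length (y # xs)"
        then show "(y # xs) ! i \<noteq> (y # xs) ! (i + 2)"
          using xs y(2) by (cases i) (auto simp: nb_walks_def nonbacktracking_def)
      qed
      ultimately show "(case p of (xs, y) \<Rightarrow> y # xs) \<in> nb_walks G (Suc (Suc k)) v"
        by (auto simp: nb_walks_def p)
    qed
  qed
  finally show ?thesis .
qed

text \<open>Non-backtracking walks of length \<open>m\<close> ending at \<open>v\<close> have deg(v)
  choices for the edge at \<open>v\<close> and at least \<open>d - 1\<close> for each of the other m
  - 1 edges. By uniqueness they start at distinct vertices.\<close>

lemma degree_mult_power_le_card_vertices:
  assumes no_cycle: "\<And>j. j \<le> 2 * m \<Longrightarrow> cycles_in G j = {}"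
    and d: "\<And>v. v \<in> vertices G \<Longrightarrow> d \<le> card (nbrs G v)"
    and v: "v \<in> vertices G" and m: "m \<ge> 1"
  shows "card (nbrs G v) * (d - 1) ^ (m - 1) \<le> card (vertices G)"
proof -
  have "card (nbrs G v) * (d - 1) ^ k \<le> card (nb_walks G (Suc k) v)" for k
  proof (induction k)
    case 0
    have "card ((\<lambda>x. [x, v]) ` nbrs G v) \<le> card (nb_walks G 1 v)"
      using nb_walks_1 finite_nb_walks by (rule card_mono[rotated])
    then show ?case
      by (simp add: card_image inj_on_def)
  next
    case (Suc k)
    then have "card (nbrs G v) * (d - 1) ^ k * (d - 1) \<le> card (nb_walks G (Suc k) v) * (d - 1)"
      by (rule mult_le_mono1)
    also have "\<dots> \<le> card (nb_walks G (Suc (Suc k)) v)"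
      by (rule card_nb_walks_Suc[OF d])
    finally show ?case by (simp add: ac_simps)
  qed
  from this[of "m - 1"] have "card (nbrs G v) * (d - 1) ^ (m - 1) \<le> card (nb_walks G m v)"
    using m by simp
  also have "\<dots> \<le> card (vertices G)"
  proof (rule card_inj_on_le[where f = "\<lambda>xs. xs ! 0"])
    show "inj_on (\<lambda>xs. xs ! 0) (nb_walks G m v)"
    proof (rule inj_onI)
      fix xs ys assume "xs \<in> nb_walks G m v" "ys \<in> nb_walks G m v" "xs ! 0 = ys ! 0"
      then have "xs \<in> walks G m (xs ! 0) v" "ys \<in> walks G m (xs ! 0) v"
        "nonbacktracking xs" "nonbacktracking ys"
        by (auto simp: nb_walks_def walks_def)
      then show "xs = ys"
        using nonbacktracking_walk_unique[OF no_cycle v] by blast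
    qed
    show "(\<lambda>xs. xs ! 0) ` nb_walks G m v \<subseteq> vertices G"
      by (auto simp: nb_walks_def walks_def)
  qed (rule finite_vertices[OF simple])
  finally show ?thesis .
qed

end

section \<open>Counting closed walks in graphs of large girth\<close>

context
  fixes G :: "'a ugraph" and m \<Delta> :: nat
  assumes simple: "simple_graph G"
    and no_cycle: "\<And>j. j \<le> 2 * m \<Longrightarrow> cycles_in G j = {}"
    and \<Delta>: "\<And>v. v \<in> vertices G \<Longrightarrow> card (nbrs G v) \<le> \<Delta>"
    and \<Delta>_pos: "\<Delta> \<ge> 1"
begin

text \<open>A closed walk of length k = r + 2 backtracks at one of r + 1 positions. Removing the
  detour, for which there are at most \<Delta> choices, leaves a closed walk of length r. The
  factors r + 1 multiply to at most k!.\<close>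

lemma num_short_closed_walks_le:
  "v \<in> vertices G \<Longrightarrow> k \<le> 2 * m \<Longrightarrow> num_walks G k v v \<le> fact k * \<Delta> ^ (k div 2)"
proof (induction k rule: less_induct)
  case (less k)
  consider "k = 0" | "k = 1" | r where "k = r + 2"
    by (metis One_nat_def add_2_eq_Suc' not0_implies_Suc)
  then show ?case
  proof cases
    case 1
    then show ?thesis by (simp add: num_walks_0)
  next
    case 2
    then show ?thesis using num_walks_1[OF simple] adj_irrefl[OF simple] by simp
  next
    case (3 r)
    let ?S = "\<lambda>i. {xs \<in> walks G (i + 2 + (r - i)) v v. xs ! i = xs ! (i + 2)}"
    have "walks G k v v \<subseteq> (\<Union>i\<le>r. ?S i)"
    proof
      fix xs assume xs: "xs \<in> walks G k v v"
      then obtain i where "i + 2 \<le> k" "xs ! i = xs ! (i + 2)"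
        using short_closed_walk_backtracks[OF simple no_cycle less.prems(1) xs] less.prems(2) 3
        by auto
      then show "xs \<in> (\<Union>i\<le>r. ?S i)"
        using xs 3 by (intro UN_I[of i]) auto
    qed
    then have "num_walks G k v v \<le> card (\<Union>i\<le>r. ?S i)"
      unfolding num_walks_def using finite_walks[OF simple less.prems(1)]
      by (intro card_mono) auto
    also have "\<dots> \<le> (\<Sum>i\<le>r. card (?S i))"
      by (rule card_UN_le) simp
    also have "\<dots> \<le> (\<Sum>i\<le>r. \<Delta> * num_walks G r v v)"
    proof (rule sum_mono)
      fix i assume "i \<in> {..r}"
      have "card (?S i)
        \<le> (\<Sum>x\<in>vertices G. num_walks G i v x * num_walks G 2 x x * num_walks G (r - i) x v)"
        by (rule card_walks_returning_le[OF simple less.prems(1)])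
      also have "\<dots> \<le> (\<Sum>x\<in>vertices G. \<Delta> * (num_walks G i v x * num_walks G (r - i) x v))"
        using \<Delta> num_walks_2[OF simple] by (intro sum_mono) (simp add: ac_simps)
      also have "\<dots> = \<Delta> * num_walks G (i + (r - i)) v v"
        by (simp only: num_walks_add[OF simple less.prems(1)] sum_distrib_left)
      finally show "card (?S i) \<le> \<Delta> * num_walks G r v v"
        using \<open>i \<in> {..r}\<close> by simp
    qed
    also have "\<dots> = Suc r * (\<Delta> * num_walks G r v v)"
      by simp
    also have "\<dots> \<le> Suc r * (\<Delta> * (fact r * \<Delta> ^ (r div 2)))"
      using less.IH[of r] less.prems 3 by (intro mult_le_mono2) auto
    also have "\<dots> = fact (Suc r) * \<Delta> ^ (k div 2)"
      using 3 by (simp add: algebra_simps)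
    also have "\<dots> \<le> fact k * \<Delta> ^ (k div 2)"
      using 3 by (intro mult_le_mono1 fact_mono_nat) simp
    finally show ?thesis .
  qed
qed

text \<open>Summing over the midpoint and using 2ab \<le> a^2 + b^2 bounds walks between two
  vertices by the closed walks of length 2m at these vertices.\<close>

lemma num_walks_2m_le:
  assumes "u \<in> vertices G" "v \<in> vertices G"
  shows "num_walks G (2 * m) u v \<le> fact (2 * m) * \<Delta> ^ m"
proof -
  have am_gm: "2 * (a * b) \<le> a * a + b * b" for a b :: nat
  proof -
    have "int (2 * (a * b)) \<le> int (a * a + b * b)"
      using sum_squares_ge_zero[of "int a - int b" 0] by (simp add: algebra_simps)
    then show ?thesis unfolding of_nat_le_iff .
  qed
  have closed: "(\<Sum>x\<in>vertices G. num_walks G m w x * num_walks G m w x) \<le> fact (2 * m) * \<Delta> ^ m"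
    if w: "w \<in> vertices G" for w
    using num_short_closed_walks_le[OF w, of "2 * m"]
    by (simp add: mult_2 num_walks_add[OF simple w] num_walks_sym[of G m _ w])
  have "2 * num_walks G (2 * m) u v = (\<Sum>x\<in>vertices G. 2 * (num_walks G m u x * num_walks G m v x))"
    by (simp add: mult_2[of m] num_walks_add[OF simple assms(1)] num_walks_sym[of G m _ v]
        sum_distrib_left)
  also have "\<dots> \<le> (\<Sum>x\<in>vertices G. num_walks G m u x * num_walks G m u x
      + num_walks G m v x * num_walks G m v x)"
    by (intro sum_mono am_gm)
  also have "\<dots> \<le> 2 * (fact (2 * m) * \<Delta> ^ m)"
    using closed[OF assms(1)] closed[OF assms(2)] by (simp only: sum.distrib)
  finally show ?thesis by simp
qed

text \<open>Each of the first \<open>j\<close> steps has at most \<Delta> choices, and 2m steps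
  remain. These need no longer form a closed walk, so the base case has to cover arbitrary
  ends.\<close>

lemma num_long_walks_le:
  "u \<in> vertices G \<Longrightarrow> v \<in> vertices G \<Longrightarrow>
    num_walks G (2 * m + j) u v \<le> fact (2 * m) * \<Delta> ^ (m + j)"
proof (induction j arbitrary: u)
  case 0
  then show ?case using num_walks_2m_le by simp
next
  case (Suc j)
  have "num_walks G (2 * m + Suc j) u v = (\<Sum>x\<in>nbrs G u. num_walks G (2 * m + j) x v)"
    using num_walks_Suc[OF simple] by simp
  also have "\<dots> \<le> (\<Sum>x\<in>nbrs G u. fact (2 * m) * \<Delta> ^ (m + j))"
    using Suc nbrs_subset[OF simple] by (intro sum_mono) blast
  also have "\<dots> \<le> \<Delta> * (fact (2 * m) * \<Delta> ^ (m + j))"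
    using \<Delta>[OF Suc.prems(1)] by simp
  finally show ?case by (simp add: ac_simps)
qed

lemma num_closed_walks_le:
  assumes "v \<in> vertices G"
  shows "num_walks G k v v \<le> fact (2 * m) * \<Delta> ^ (if k \<le> 2 * m then k div 2 else k - m)"
proof (cases "k \<le> 2 * m")
  case True
  have "num_walks G k v v \<le> fact k * \<Delta> ^ (k div 2)"
    by (rule num_short_closed_walks_le[OF assms True])
  also have "\<dots> \<le> fact (2 * m) * \<Delta> ^ (k div 2)"
    using True by (intro mult_le_mono1 fact_mono_nat)
  finally show ?thesis
    using True by simp
next
  case False
  then show ?thesis
    using num_long_walks_le[OF assms assms, of "k - 2 * m"] by simp
qed

text \<open>The exponent is one less than 2l - m, the one available for a single closed walk of
  length 2l: splitting a walk saves a factor \<Delta>.\<close>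

lemma num_closed_walk_pairs_le:
  assumes v: "v \<in> vertices G" and l: "m < l" and m: "1 \<le> m" and ab: "a + b = 2 * l" "1 \<le> a" "1 \<le> b"
  shows "num_walks G a v v * num_walks G b v v \<le> (fact (2 * m))\<^sup>2 * \<Delta> ^ (2 * l - 1 - m)"
proof -
  define e where "e k = (if k \<le> 2 * m then k div 2 else k - m)" for k
  have "num_walks G a v v * num_walks G b v v
      \<le> (fact (2 * m) * \<Delta> ^ e a) * (fact (2 * m) * \<Delta> ^ e b)"
    using num_closed_walks_le[OF v] unfolding e_def by (intro mult_le_mono)
  also have "\<dots> = (fact (2 * m))\<^sup>2 * \<Delta> ^ (e a + e b)"
    by (simp add: power2_eq_square power_add)
  also have "\<dots> \<le> (fact (2 * m))\<^sup>2 * \<Delta> ^ (2 * l - 1 - m)"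
  proof (intro mult_le_mono2 power_increasing)
    \<comment> \<open>If \<open>a\<close> and \<open>b\<close> are at most 2m, the sum is at most l,
      and l > m suffices. If only \<open>a\<close> exceeds 2m, it is 2l - m - (b - b div 2), and b
      \<ge> 1 gives the saving. If both exceed 2m, it is 2l - 2m, and m \<ge> 1 suffices.\<close>
    show "e a + e b \<le> 2 * l - 1 - m"
      using l m ab unfolding e_def by auto
  qed (use \<Delta>_pos in simp)
  finally show ?thesis .
qed

section \<open>Closed walks of length 2l: those repeating a vertex and those tracing a cycle\<close>

text \<open>For each pair of positions i < j holding the same vertex x, the part between them is a
  closed walk at x. Summed over the base point v, the two outer parts join at v to another closed
  walk at x, and the bound on pairs applies.\<close>

lemma degenerate_closed_walks_le:
  assumes l: "m < l" and m: "1 \<le> m"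
  shows "(\<Sum>v\<in>vertices G. card {xs \<in> walks G (2 * l) v v. \<not> distinct (take (2 * l) xs)})
    \<le> (2 * l)\<^sup>2 * (card (vertices G) * ((fact (2 * m))\<^sup>2 * \<Delta> ^ (2 * l - 1 - m)))"
    (is "_ \<le> _ * ?B")
proof -
  \<comment> \<open>\<open>j < 2 * l\<close> leaves out the pair (0, 2l), where every closed walk
    agrees. Hence both closed parts have positive length.\<close>
  define P where "P = {(i, j). i < j \<and> j < 2 * l}"
  have P_sub: "P \<subseteq> {..<2 * l} \<times> {..<2 * l}"
    by (auto simp: P_def)
  then have finP: "finite P"
    by (rule finite_subset) simp
  have cardP: "card P \<le> (2 * l)\<^sup>2"
    using card_mono[OF _ P_sub] by (simp add: power2_eq_square)
  let ?S = "\<lambda>v p. {xs \<in> walks G (2 * l) v v. xs ! fst p = xs ! snd p}"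
  have "card {xs \<in> walks G (2 * l) v v. \<not> distinct (take (2 * l) xs)} \<le> (\<Sum>p\<in>P. card (?S v p))"
    if v: "v \<in> vertices G" for v
  proof -
    have "{xs \<in> walks G (2 * l) v v. \<not> distinct (take (2 * l) xs)} \<subseteq> (\<Union>p\<in>P. ?S v p)"
    proof (rule subsetI, elim CollectE conjE)
      fix xs assume xs: "xs \<in> walks G (2 * l) v v" "\<not> distinct (take (2 * l) xs)"
      then have "length xs = Suc (2 * l)" by (simp add: walks_def)
      then obtain i j where "i < 2 * l" "j < 2 * l" "i \<noteq> j" "xs ! i = xs ! j"
        using xs(2) by (auto simp: distinct_conv_nth)
      then obtain i j where "i < j" "j < 2 * l" "xs ! i = xs ! j"
        by (metis linorder_neqE_nat)
      then show "xs \<in> (\<Union>p\<in>P. ?S v p)"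
        using xs(1) by (intro UN_I[of "(i, j)"]) (auto simp: P_def)
    qed
    then have "card {xs \<in> walks G (2 * l) v v. \<not> distinct (take (2 * l) xs)}
        \<le> card (\<Union>p\<in>P. ?S v p)"
      using finP finite_walks[OF simple v] by (intro card_mono) auto
    also have "\<dots> \<le> (\<Sum>p\<in>P. card (?S v p))"
      by (rule card_UN_le[OF finP])
    finally show ?thesis .
  qed
  then have "(\<Sum>v\<in>vertices G. card {xs \<in> walks G (2 * l) v v. \<not> distinct (take (2 * l) xs)})
      \<le> (\<Sum>v\<in>vertices G. \<Sum>p\<in>P. card (?S v p))"
    by (rule sum_mono)
  also have "\<dots> = (\<Sum>p\<in>P. \<Sum>v\<in>vertices G. card (?S v p))"
    by (rule sum.swap)
  also have "\<dots> \<le> (\<Sum>p\<in>P. ?B)"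
  proof (rule sum_mono)
    fix p assume "p \<in> P"
    then obtain i j where p: "p = (i, j)" and ij: "i < j" "j < 2 * l"
      by (auto simp: P_def)
    let ?w = "num_walks G"
    have "(\<Sum>v\<in>vertices G. card (?S v p))
        \<le> (\<Sum>v\<in>vertices G. \<Sum>x\<in>vertices G. ?w i v x * ?w (j - i) x x * ?w (2 * l - j) x v)"
    proof (rule sum_mono)
      fix v assume v: "v \<in> vertices G"
      show "card (?S v p)
        \<le> (\<Sum>x\<in>vertices G. ?w i v x * ?w (j - i) x x * ?w (2 * l - j) x v)"
        using card_walks_returning_le[OF simple v, of i "j - i" "2 * l - j" v] ij by (simp add: p)
    qed
    also have "\<dots> = (\<Sum>x\<in>vertices G. \<Sum>v\<in>vertices G. ?w i v x * ?w (j - i) x x * ?w (2 * l - j) x v)"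
      by (rule sum.swap)
    also have "\<dots> = (\<Sum>x\<in>vertices G. ?w (j - i) x x * ?w (2 * l - j + i) x x)"
    proof (rule sum.cong[OF refl])
      fix x assume x: "x \<in> vertices G"
      show "(\<Sum>v\<in>vertices G. ?w i v x * ?w (j - i) x x * ?w (2 * l - j) x v)
          = ?w (j - i) x x * ?w (2 * l - j + i) x x"
        unfolding num_walks_add[OF simple x, of "2 * l - j" i] sum_distrib_left
        by (intro sum.cong refl) (simp only: ac_simps)
    qed
    also have "\<dots> \<le> (\<Sum>x\<in>vertices G. (fact (2 * m))\<^sup>2 * \<Delta> ^ (2 * l - 1 - m))"
      using ij l m by (intro sum_mono num_closed_walk_pairs_le) auto
    also have "\<dots> = ?B" by simp
    finally show "(\<Sum>v\<in>vertices G. card (?S v p)) \<le> ?B" .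
  qed
  also have "\<dots> = card P * ?B"
    by simp
  also have "\<dots> \<le> (2 * l)\<^sup>2 * ?B"
    by (rule mult_le_mono1[OF cardP])
  finally show ?thesis .
qed

text \<open>The factor generously counts all lists of length 2l over the 2l vertices of a cycle,
  instead of the 4l closed walks that trace it. \<open>take (2 * l)\<close> loses nothing, as the
  last vertex of a closed walk is its first.\<close>

lemma cyclic_closed_walks_le:
  assumes l: "2 \<le> l"
  shows "(\<Sum>v\<in>vertices G. card {xs \<in> walks G (2 * l) v v. distinct (take (2 * l) xs)})
    \<le> (2 * l) ^ (2 * l) * card (cycles_in G (2 * l))"
proof -
  let ?S = "\<lambda>v. {xs \<in> walks G (2 * l) v v. distinct (take (2 * l) xs)}"
  let ?L = "\<lambda>C. {ys. set ys \<subseteq> vertices C \<and> length ys = 2 * l}"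
  have finC: "finite (vertices C) \<and> card (vertices C) = 2 * l" if C: "C \<in> cycles_in G (2 * l)" for C
  proof -
    obtain xs where "distinct xs" "length xs = 2 * l" "vertices C = set xs"
      using C unfolding cycles_in_def is_cycle_graph_def by blast
    then show ?thesis by (simp add: distinct_card)
  qed
  have "(\<Sum>v\<in>vertices G. card (?S v)) = card (\<Union>v\<in>vertices G. ?S v)"
  proof (rule card_UN_disjoint[symmetric, OF finite_vertices[OF simple]])
    show "\<forall>v\<in>vertices G. finite (?S v)"
      using finite_walks[OF simple] by simp
    show "\<forall>v\<in>vertices G. \<forall>w\<in>vertices G. v \<noteq> w \<longrightarrow> ?S v \<inter> ?S w = {}"
      by (auto simp: walks_def)
  qed
  also have "\<dots> \<le> card (\<Union>C\<in>cycles_in G (2 * l). ?L C)"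
  proof (rule card_inj_on_le[where f = "take (2 * l)"])
    show "inj_on (take (2 * l)) (\<Union>v\<in>vertices G. ?S v)"
    proof (rule inj_onI)
      fix xs ys
      assume "xs \<in> (\<Union>v\<in>vertices G. ?S v)" "ys \<in> (\<Union>v\<in>vertices G. ?S v)"
        and eq: "take (2 * l) xs = take (2 * l) ys"
      then have len: "length xs = Suc (2 * l)" "length ys = Suc (2 * l)"
        and ends: "xs ! (2 * l) = xs ! 0" "ys ! (2 * l) = ys ! 0"
        by (auto simp: walks_def)
      have "xs ! 0 = ys ! 0"
        using arg_cong[OF eq, of "\<lambda>zs. zs ! 0"] l by simp
      moreover have "xs = take (2 * l) xs @ [xs ! (2 * l)]" "ys = take (2 * l) ys @ [ys ! (2 * l)]"
        using take_Suc_conv_app_nth[of "2 * l" xs] take_Suc_conv_app_nth[of "2 * l" ys] len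
        by simp_all
      ultimately show "xs = ys" using eq ends by metis
    qed
    show "take (2 * l) ` (\<Union>v\<in>vertices G. ?S v) \<subseteq> (\<Union>C\<in>cycles_in G (2 * l). ?L C)"
    proof (rule image_subsetI)
      fix xs assume "xs \<in> (\<Union>v\<in>vertices G. ?S v)"
      then obtain v where v: "v \<in> vertices G" "xs \<in> walks G (2 * l) v v" "distinct (take (2 * l) xs)"
        by blast
      have "list_cycle (take (2 * l) xs) \<in> cycles_in G (2 * l)"
        using list_cycle_in_cycles_in[OF simple v] l by simp
      moreover have "take (2 * l) xs \<in> ?L (list_cycle (take (2 * l) xs))"
        using v(2) by (simp add: list_cycle_def walks_def)
      ultimately show "take (2 * l) xs \<in> (\<Union>C\<in>cycles_in G (2 * l). ?L C)"
        by (rule UN_I)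
    qed
    show "finite (\<Union>C\<in>cycles_in G (2 * l). ?L C)"
      using finite_cycles_in[OF simple] finC by (intro finite_UN_I finite_lists_length_eq) auto
  qed
  also have "\<dots> \<le> (\<Sum>C\<in>cycles_in G (2 * l). card (?L C))"
    by (rule card_UN_le[OF finite_cycles_in[OF simple]])
  also have "\<dots> = (\<Sum>C\<in>cycles_in G (2 * l). (2 * l) ^ (2 * l))"
    using finC by (intro sum.cong refl) (simp add: card_lists_length_eq)
  finally show ?thesis by (simp add: mult.commute)
qed

text \<open>The lower bound for closed walks meets the two upper bounds. When \<Delta> = O(d) and
  the order is O(d^m), the second summand is O(d^(2l-1)), of smaller order than the left
  side.\<close>

lemma min_degree_power_le:
  assumes ne: "vertices G \<noteq> {}" and d: "\<And>v. v \<in> vertices G \<Longrightarrow> d \<le> card (nbrs G v)"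
    and l: "m < l" and m: "1 \<le> m"
  shows "d ^ (2 * l) \<le> (2 * l) ^ (2 * l) * card (cycles_in G (2 * l))
    + (2 * l)\<^sup>2 * (card (vertices G) * ((fact (2 * m))\<^sup>2 * \<Delta> ^ (2 * l - 1 - m)))"
proof -
  let ?D = "\<lambda>v. {xs \<in> walks G (2 * l) v v. distinct (take (2 * l) xs)}"
  let ?N = "\<lambda>v. {xs \<in> walks G (2 * l) v v. \<not> distinct (take (2 * l) xs)}"
  have "d ^ (2 * l) \<le> (\<Sum>v\<in>vertices G. num_walks G (2 * l) v v)"
    by (rule power_le_sum_closed_walks[OF simple d ne])
  also have "\<dots> \<le> (\<Sum>v\<in>vertices G. card (?D v) + card (?N v))"
  proof (rule sum_mono)
    fix v
    have "?D v \<union> ?N v = walks G (2 * l) v v" by blast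
    then show "num_walks G (2 * l) v v \<le> card (?D v) + card (?N v)"
      using card_Un_le[of "?D v" "?N v"] by (simp only: num_walks_def)
  qed
  also have "\<dots> = (\<Sum>v\<in>vertices G. card (?D v)) + (\<Sum>v\<in>vertices G. card (?N v))"
    by (rule sum.distrib)
  also have "\<dots> \<le> (2 * l) ^ (2 * l) * card (cycles_in G (2 * l))
    + (2 * l)\<^sup>2 * (card (vertices G) * ((fact (2 * m))\<^sup>2 * \<Delta> ^ (2 * l - 1 - m)))"
    by (rule add_le_mono[OF cyclic_closed_walks_le degenerate_closed_walks_le]) (use l m in auto)
  finally show ?thesis .
qed

end

section \<open>Passing to a subgraph of large minimum degree\<close>

lemma cycles_in_subgraph_mono: "is_subgraph H G \<Longrightarrow> cycles_in H j \<subseteq> cycles_in G j"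
  by (auto simp: cycles_in_def is_subgraph_def)

text \<open>Deleting a vertex of degree below \<open>t\<close> costs one vertex and fewer than
  \<open>t\<close> edges, so the hypothesis on the number of edges survives and the deletions stop
  before the graph is empty.\<close>

lemma exists_subgraph_min_degree:
  assumes "simple_graph G" "0 < t" "vertices G \<noteq> {}"
    and "t * real (card (vertices G)) \<le> real (card (edges G))"
  shows "\<exists>H. simple_graph H \<and> is_subgraph H G \<and> vertices H \<noteq> {} \<and>
    (\<forall>v\<in>vertices H. t \<le> real (card (nbrs H v)))"
  using assms
proof (induction "card (vertices G)" arbitrary: G rule: less_induct)
  case less
  note simple = \<open>simple_graph G\<close>
  show ?case
  proof (cases "\<forall>v\<in>vertices G. t \<le> real (card (nbrs G v))")
    case True
    then show ?thesis
      using less.prems by (intro exI[of _ G]) (auto simp: is_subgraph_def)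
  next
    case False
    then obtain v where v: "v \<in> vertices G" "real (card (nbrs G v)) < t"
      by auto
    define H where "H = \<lparr>vertices = vertices G - {v}, edges = {e \<in> edges G. v \<notin> e}\<rparr>"
    have simpleH: "simple_graph H"
      using simple by (auto simp: H_def simple_graph_def)
    have "{e \<in> edges G. v \<in> e} \<subseteq> (\<lambda>w. {v, w}) ` nbrs G v"
    proof
      fix e assume e: "e \<in> {e \<in> edges G. v \<in> e}"
      then have "card e = 2" using simple by (auto simp: simple_graph_def)
      then obtain w where "e = {v, w}"
        using e by (auto simp: card_2_iff)
      then show "e \<in> (\<lambda>w. {v, w}) ` nbrs G v"
        using e by (auto simp: nbrs_def adj_def)
    qed
    then have deg: "card {e \<in> edges G. v \<in> e} \<le> card (nbrs G v)"
      using finite_nbrs[OF simple] by (rule surj_card_le[rotated])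
    have "card (edges G) = card ({e \<in> edges G. v \<in> e} \<union> edges H)"
      by (intro arg_cong[of _ _ card]) (auto simp: H_def)
    also have "\<dots> \<le> card {e \<in> edges G. v \<in> e} + card (edges H)"
      by (rule card_Un_le)
    finally have "real (card (edges G)) < t + real (card (edges H))"
      using deg v by linarith
    moreover have cardH: "card (vertices G) = Suc (card (vertices H))"
      using v finite_vertices[OF simple] by (simp add: H_def card_Suc_Diff1 del: card_Diff_insert card_Diff_singleton)
    \<comment> \<open>The inequality has become strict, which excludes the empty graph, where both
      sides are 0.\<close>
    ultimately have size: "t * real (card (vertices H)) < real (card (edges H))"
      using less.prems(4) by (simp add: algebra_simps)
    have "vertices H \<noteq> {}"
    proof
      assume "vertices H = {}"
      then have "edges H = {}"
        using simpleH unfolding simple_graph_def by fastforce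
      then show False using size \<open>0 < t\<close> by (simp add: mult_less_0_iff)
    qed
    then obtain K where K: "simple_graph K" "is_subgraph K H" "vertices K \<noteq> {}"
      "\<forall>v\<in>vertices K. t \<le> real (card (nbrs K v))"
      using less.hyps[of H] simpleH cardH size \<open>0 < t\<close> by auto
    then have "is_subgraph K G"
      by (auto simp: is_subgraph_def H_def)
    with K show ?thesis by blast
  qed
qed

section \<open>Choice of constants and conclusion\<close>

text \<open>\<open>D\<close> stands for n^(1/m), with n the order of the ambient graph.
  \<open>K * D\<close> bounds the degrees and \<open>A * D ^ (2 * l - 1)\<close> the degenerate
  walks; \<open>D2\<close> makes the latter at most half of
  \<open>(c * D) ^ (2 * l)\<close>.\<close>

lemma cycles_lower_bound_if_min_degree:
  fixes H :: "'a ugraph" and c D :: real and l m :: nat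
  defines "K \<equiv> (2 / c) ^ (m - 1)"
  defines "A \<equiv> real ((2 * l)\<^sup>2 * (fact (2 * m))\<^sup>2) * K ^ (2 * l - 1 - m)"
  assumes simple: "simple_graph H" and ne: "vertices H \<noteq> {}"
    and no_cycle: "\<And>j. j \<le> 2 * m \<Longrightarrow> cycles_in H j = {}"
    and order: "real (card (vertices H)) \<le> D ^ m"
    and deg: "\<And>v. v \<in> vertices H \<Longrightarrow> c * D \<le> real (card (nbrs H v))"
    and c: "0 < c" and D1: "2 / c \<le> D" and D2: "2 * A / c ^ (2 * l) \<le> D"
    and m: "1 \<le> m" and l: "m < l"
  shows "c ^ (2 * l) * D ^ (2 * l) / 2 \<le> real ((2 * l) ^ (2 * l)) * real (card (cycles_in H (2 * l)))"
proof -
  have cD: "2 \<le> c * D" using D1 c by (simp add: field_simps)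
  have D: "0 < D" using D1 c by (smt (verit) divide_pos_pos)
  define d where "d = nat \<lceil>c * D\<rceil>"
  have d_ge: "c * D \<le> real d"
    unfolding d_def by linarith
  have d_le: "d \<le> card (nbrs H v)" if "v \<in> vertices H" for v
    using deg[OF that] unfolding d_def by linarith
  define \<Delta> where "\<Delta> = Max ((\<lambda>v. card (nbrs H v)) ` vertices H)"
  have fin: "finite (vertices H)" by (rule finite_vertices[OF simple])
  have \<Delta>: "card (nbrs H v) \<le> \<Delta>" if "v \<in> vertices H" for v
    using fin that by (simp add: \<Delta>_def)
  have "\<Delta> \<in> (\<lambda>v. card (nbrs H v)) ` vertices H"
    unfolding \<Delta>_def using fin ne by (intro Max_in) auto
  then obtain v where v: "v \<in> vertices H" "\<Delta> = card (nbrs H v)"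
    by blast
  have "1 \<le> d" using d_ge cD by linarith
  then have \<Delta>_pos: "1 \<le> \<Delta>"
    using d_le[OF v(1)] v(2) by linarith
  have "real \<Delta> \<le> K * D"
  proof -
    \<comment> \<open>From \<open>2 \<le> c * D\<close> follows c D / 2 \<le> c D - 1 \<le> d -
      1.\<close>
    have "real \<Delta> * (c * D / 2) ^ (m - 1) \<le> real \<Delta> * real (d - 1) ^ (m - 1)"
      using d_ge cD \<open>1 \<le> d\<close> by (intro mult_left_mono power_mono) auto
    also have "\<dots> = real (\<Delta> * (d - 1) ^ (m - 1))"
      by simp
    also have "\<dots> \<le> real (card (vertices H))"
      unfolding of_nat_le_iff v(2)
      by (rule degree_mult_power_le_card_vertices[OF simple no_cycle d_le v(1) m])
    also have "\<dots> \<le> D ^ m" by (rule order)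
    also have "D ^ m = D * D ^ (m - 1)"
      using m by (cases m) auto
    finally have "real \<Delta> * (c / 2) ^ (m - 1) * D ^ (m - 1) \<le> D * D ^ (m - 1)"
      by (simp add: power_mult_distrib power_divide)
    then have "real \<Delta> * (c / 2) ^ (m - 1) \<le> D"
      using D by simp
    then show ?thesis
      using c by (simp add: K_def power_divide field_simps)
  qed
  then have \<Delta>_pow: "real \<Delta> ^ (2 * l - 1 - m) \<le> K ^ (2 * l - 1 - m) * D ^ (2 * l - 1 - m)"
    by (metis power_mono of_nat_0_le_iff power_mult_distrib)
  let ?cyc = "real ((2 * l) ^ (2 * l)) * real (card (cycles_in H (2 * l)))"
  let ?E = "real ((2 * l)\<^sup>2 * (fact (2 * m))\<^sup>2)"
  have "c ^ (2 * l) * D ^ (2 * l) \<le> real d ^ (2 * l)"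
    unfolding power_mult_distrib[symmetric] using d_ge cD by (intro power_mono) auto
  also have "\<dots> = real (d ^ (2 * l))" by simp
  also have "\<dots> \<le> real ((2 * l) ^ (2 * l) * card (cycles_in H (2 * l))
      + (2 * l)\<^sup>2 * (card (vertices H) * ((fact (2 * m))\<^sup>2 * \<Delta> ^ (2 * l - 1 - m))))"
    unfolding of_nat_le_iff
    by (rule min_degree_power_le[OF simple no_cycle \<Delta> \<Delta>_pos ne d_le l m])
  also have "\<dots> = ?cyc + ?E * (real (card (vertices H)) * real \<Delta> ^ (2 * l - 1 - m))"
    by simp
  also have "\<dots> \<le> ?cyc + ?E * (D ^ m * (K ^ (2 * l - 1 - m) * D ^ (2 * l - 1 - m)))"
    using D by (intro add_left_mono mult_left_mono mult_mono order \<Delta>_pow) auto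
  also have "\<dots> = ?cyc + A * D ^ (m + (2 * l - 1 - m))"
    by (simp add: A_def power_add)
  also have "m + (2 * l - 1 - m) = 2 * l - 1"
    using l by simp
  also have "?cyc + A * D ^ (2 * l - 1) \<le> ?cyc + c ^ (2 * l) * D / 2 * D ^ (2 * l - 1)"
    using D D2 c by (intro add_left_mono mult_right_mono) (auto simp: field_simps)
  also have "c ^ (2 * l) * D / 2 * D ^ (2 * l - 1) = c ^ (2 * l) * D ^ (2 * l) / 2"
    using l power_Suc[of D "2 * l - 1"] by simp
  finally show ?thesis by simp
qed

lemma cycles_lower_bound:
  fixes c :: real and l m :: nat
  assumes c: "c > 0" and m: "1 \<le> m" and l: "m < l"
  shows "\<exists>\<alpha>::real. \<alpha> > 0 \<and> (\<exists>N::nat. \<forall>n\<ge>N. \<forall>G::'a ugraph.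
    simple_graph G \<and> graph_order G = n \<and>
    real (graph_size G) \<ge> c * real n powr (1 + 1 / real m) \<and> girth G > enat (2 * m) \<longrightarrow>
    real (card (cycles_in G (2 * l))) \<ge> \<alpha> * real n powr (2 * real l / real m))"
proof -
  define A where
    "A = real ((2 * l)\<^sup>2 * (fact (2 * m))\<^sup>2) * ((2 / c) ^ (m - 1)) ^ (2 * l - 1 - m)"
  \<comment> \<open>\<open>B\<close> collects both lower bounds required of n^(1/m).\<close>
  define B where "B = max (2 / c) (2 * A / c ^ (2 * l))"
  define L where "L = real ((2 * l) ^ (2 * l))"
  \<comment> \<open>Half of the main term remains; \<open>L\<close> accounts for the closed walks
    per cycle.\<close>
  define \<alpha> where "\<alpha> = c ^ (2 * l) / (2 * L)"
  \<comment> \<open>n \<ge> N gives B^m \<le> n, that is B \<le> n^(1/m); \<open>Suc\<close> also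
    gives n \<ge> 1.\<close>
  define N where "N = Suc (nat \<lceil>B ^ m\<rceil>)"
  have L: "0 < L" using l by (simp add: L_def)
  have "\<alpha> > 0" using c L by (simp add: \<alpha>_def)
  moreover have "\<alpha> * real n powr (2 * real l / real m) \<le> real (card (cycles_in G (2 * l)))"
    if n: "N \<le> n" and simple: "simple_graph G" and order: "graph_order G = n"
      and size: "c * real n powr (1 + 1 / real m) \<le> real (graph_size G)"
      and girth: "girth G > enat (2 * m)" for n and G :: "'a ugraph"
  proof -
    define D where "D = real n powr (1 / real m)"
    have n1: "1 \<le> n" using n by (simp add: N_def)
    then have D: "0 < D" by (simp add: D_def)
    have Dm: "D ^ m = real n"
      using n1 m by (simp add: D_def powr_powr flip: powr_realpow)
    have "B ^ m \<le> real n"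
      using n unfolding N_def by linarith
    then have "B ^ m \<le> D ^ m" by (simp add: Dm)
    then have BD: "B \<le> D"
      using m D by (metis power_le_imp_le_base less_imp_le Suc_diff_1 One_nat_def less_eq_Suc_le)
    have D2l: "real n powr (2 * real l / real m) = D ^ (2 * l)"
      using n1 by (simp add: D_def powr_powr flip: powr_realpow)
    \<comment> \<open>n^(1+1/m) = D n, so the density is c D, which becomes the minimum degree of
      the subgraph.\<close>
    have "c * D * real (card (vertices G)) \<le> real (card (edges G))"
      using size order n1 by (simp add: D_def graph_order_def graph_size_def powr_add mult_ac)
    moreover have "vertices G \<noteq> {}"
      using order n1 by (auto simp: graph_order_def)
    ultimately obtain H where H: "simple_graph H" "is_subgraph H G" "vertices H \<noteq> {}"
      "\<forall>v\<in>vertices H. c * D \<le> real (card (nbrs H v))"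
      using exists_subgraph_min_degree[OF simple, of "c * D"] c D by auto
    have "card (vertices H) \<le> n"
      using H(2) order finite_vertices[OF simple]
      by (auto simp: is_subgraph_def graph_order_def intro: card_mono)
    then have orderH: "real (card (vertices H)) \<le> D ^ m"
      by (simp add: Dm)
    have no_cycle: "cycles_in H j = {}" if "j \<le> 2 * m" for j
      using cycles_in_subgraph_mono[OF H(2)] cycles_in_empty_if_girth_gt[OF girth that] by blast
    have "c ^ (2 * l) * D ^ (2 * l) / 2 \<le> L * real (card (cycles_in H (2 * l)))"
      unfolding L_def
      by (rule cycles_lower_bound_if_min_degree[OF H(1,3) no_cycle orderH _ c _ _ m l])
        (use H(4) BD in \<open>auto simp: A_def B_def\<close>)
    also have "\<dots> \<le> L * real (card (cycles_in G (2 * l)))"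
      using L card_mono[OF finite_cycles_in[OF simple] cycles_in_subgraph_mono[OF H(2)]]
      by (intro mult_left_mono) auto
    finally show ?thesis
      unfolding \<alpha>_def D2l using L by (simp add: field_simps)
  qed
  ultimately show ?thesis by blast
qed

theorem theorem2:
  fixes c :: real and M m :: nat
  assumes "c > 0" and "M > m" and "m \<ge> 2"
  shows "\<exists>\<alpha>::real. \<alpha> > 0 \<and> (\<exists>N::nat.
    \<forall>(I::nat set) (G::nat \<Rightarrow> 'a ugraph).
      (\<forall>n\<in>I. simple_graph (G n) \<and> graph_order (G n) = n \<and>
        real (graph_size (G n)) \<ge> c * real n powr (1 + 1 / real m) \<and>
        girth (G n) > enat (2 * m))
      \<longrightarrow> (\<forall>n\<in>I. n \<ge> N \<longrightarrow> (\<forall>l::nat. m + 1 \<le> l \<and> l \<le> M \<longrightarrow>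
        real (card (cycles_in (G n) (2 * l))) \<ge> \<alpha> * real n powr (2 * real l / real m))))"
proof -
  \<comment> \<open>The pair \<open>p\<close> holds the constant and the threshold for one
    \<open>l\<close>, so that a single choice function yields both.\<close>
  have "\<forall>l\<in>{m+1..M}. \<exists>p. fst p > (0::real) \<and> (\<forall>n\<ge>snd p. \<forall>G::'a ugraph.
    simple_graph G \<and> graph_order G = n \<and>
    real (graph_size G) \<ge> c * real n powr (1 + 1 / real m) \<and> girth G > enat (2 * m) \<longrightarrow>
    real (card (cycles_in G (2 * l))) \<ge> fst p * real n powr (2 * real l / real m))"
  proof
    fix l assume "l \<in> {m+1..M}"
    then have "m < l" "1 \<le> m" using assms by auto
    from cycles_lower_bound[OF assms(1) this(2,1), where ?'a = 'a]
    show "\<exists>p. fst p > (0::real) \<and> (\<forall>n\<ge>snd p. \<forall>G::'a ugraph.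
      simple_graph G \<and> graph_order G = n \<and>
      real (graph_size G) \<ge> c * real n powr (1 + 1 / real m) \<and> girth G > enat (2 * m) \<longrightarrow>
      real (card (cycles_in G (2 * l))) \<ge> fst p * real n powr (2 * real l / real m))"
      by simp
  qed
  from bchoice[OF this] obtain f where
    f: "\<And>l. l \<in> {m+1..M} \<Longrightarrow> 0 < (fst (f l) :: real)"
      "\<And>l n G. l \<in> {m+1..M} \<Longrightarrow> snd (f l) \<le> n \<Longrightarrow> simple_graph (G :: 'a ugraph) \<Longrightarrow>
        graph_order G = n \<Longrightarrow> real (graph_size G) \<ge> c * real n powr (1 + 1 / real m) \<Longrightarrow>
        girth G > enat (2 * m) \<Longrightarrow>
        real (card (cycles_in G (2 * l))) \<ge> fst (f l) * real n powr (2 * real l / real m)"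
    by blast
  \<comment> \<open>Only finitely many \<open>l\<close> occur, so the smallest constant and the
    largest threshold serve all of them; \<open>M > m\<close> makes the range nonempty.\<close>
  define \<alpha> where "\<alpha> = Min ((\<lambda>l. fst (f l)) ` {m+1..M})"
  define N where "N = Max ((\<lambda>l. snd (f l)) ` {m+1..M})"
  have "\<alpha> > 0"
    unfolding \<alpha>_def using assms f(1) by (subst Min_gr_iff) auto
  moreover have "\<alpha> * real n powr (2 * real l / real m) \<le> real (card (cycles_in G (2 * l)))"
    if "simple_graph G" "graph_order G = n" "c * real n powr (1 + 1 / real m) \<le> real (graph_size G)"
      "girth G > enat (2 * m)" "N \<le> n" "m + 1 \<le> l" "l \<le> M" for n l and G :: "'a ugraph"
  proof -
    have "\<alpha> \<le> fst (f l)" "snd (f l) \<le> N"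
      using that by (auto simp: \<alpha>_def N_def)
    then have "\<alpha> * real n powr (2 * real l / real m) \<le> fst (f l) * real n powr (2 * real l / real m)"
      by (intro mult_right_mono) auto
    also have "\<dots> \<le> real (card (cycles_in G (2 * l)))"
      using that \<open>snd (f l) \<le> N\<close> by (intro f(2)[of l n G]) auto
    finally show ?thesis .
  qed
  ultimately show ?thesis
    by (intro exI[of _ \<alpha>] conjI exI[of _ N]) auto
qed

end
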